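(* Let $\mu,\nu\in\mathrm{M}_0(\mathbb{R}^d)$ and assume that for every $y\in\mathrm{spt}\,\nu\setminus\{0\}$ there exists $\varepsilon>0$ such that $\mu(H_+(y,\varepsilon))=\infty$, where $$H_+(y,\varepsilon)=\{x\in\mathbb{R}^d\setminus\{0\}:\langle x/\|x\|,y\rangle>\varepsilon\}.$$ Then every $\gamma\in\Gamma_{0,\mathrm{m}}(\mu,\nu)$ is proper, and therefore also every $\gamma\in\Gamma_{0,\mathrm{cm}}(\mu,\nu)$ is proper.
   Context: $\mathrm{M}_0(\mathbb{R}^k)$ denotes the set of nonnegative Borel measures $\mu$ on $\mathbb{R}^k\setminus\{0\}$ such that $\mu(B)<\infty$ for every Borel set $B\subset\mathbb{R}^k\setminus\{0\}$ with $0\notin \mathrm{cl}(B)$ (closure in $\mathbb{R}^k$). The support $\mathrm{spt}\,\mu$ is the set of $x\in\mathbb{R}^k$ such that $\mu(U\setminus\{0\})>0$ for every open $U\subset\mathbb{R}^k$ containing $x$ (so $0$ may belong to $\mathrm{spt}\,\mu$). For $\mu,\nu\in\mathrm{M}_0(\mathbb{R}^d)$, a zero-coupling between $\mu$ and $\nu$ is a nonnegative Borel measure $\gamma$ on $(\mathbb{R}^d\times\mathbb{R}^d)\setminus\{(0,0)\}$ such that $\gamma(A\times\mathbb{R}^d)=\mu(A)$ and $\gamma(\mathbb{R}^d\times A)=\nu(A)$ for all Borel $A\subset\mathbb{R}^d\setminus\{0\}$; any such $\gamma$ belongs to $\mathrm{M}_0(\mathbb{R}^d\times\mathbb{R}^d)=\mathrm{M}_0(\mathbb{R}^{2d})$.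 $\Gamma_{0,\mathrm{m}}(\mu,\nu)$ and $\Gamma_{0,\mathrm{cm}}(\mu,\nu)$ are the sets of zero-couplings whose support is monotone and cyclically monotone, respectively. A set $T\subset\mathbb{R}^d\times\mathbb{R}^d$ is monotone if $\langle x_1-x_2,y_1-y_2\rangle\ge0$ for all $(x_1,y_1),(x_2,y_2)\in T$; it is cyclically monotone if for every $n\ge 2$ and all $(x_1,y_1),\dots,(x_n,y_n)\in T$, with $y_{n+1}:=y_1$, $\sum_{i=1}^n\langle x_i,y_i\rangle\ge\sum_{i=1}^n\langle x_i,y_{i+1}\rangle$. A zero-coupling $\gamma$ is proper if $\gamma(\{0\}\times(\mathbb{R}^d\setminus\{0\}))=0$. *)

theory Defs
  imports "HOL-Analysis.Analysis"
begin

definition borel_measures_off_0 :: "'a::euclidean_space measure set" where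
  "borel_measures_off_0 = {M. sets M = sets (restrict_space borel (UNIV - {0}))}"

definition M0 :: "'a::euclidean_space measure set" where
  "M0 = {M \<in> borel_measures_off_0.
     \<forall>B \<in> sets M. 0 \<notin> closure B \<longrightarrow> emeasure M B < \<infinity>}"

text \<open>The support is a subset of the whole space: it may contain the origin, although
  the measure lives on the complement of the origin.\<close>

definition spt :: "'a::euclidean_space measure \<Rightarrow> 'a set" where
  "spt M = {x. \<forall>U. open U \<longrightarrow> x \<in> U \<longrightarrow> emeasure M (U - {0}) > 0}"

definition zero_couplings ::
  "'a::euclidean_space measure \<Rightarrow> 'a measure \<Rightarrow> ('a \<times> 'a) measure set" where
  "zero_couplings \<mu> \<nu> = {\<gamma> \<in> borel_measures_off_0.
     \<forall>A \<in> sets borel. A \<subseteq> UNIV - {0} \<longrightarrow>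
       emeasure \<gamma> (A \<times> UNIV) = emeasure \<mu> A \<and> emeasure \<gamma> (UNIV \<times> A) = emeasure \<nu> A}"

definition monotone_set :: "('a::real_inner \<times> 'a) set \<Rightarrow> bool" where
  "monotone_set T \<longleftrightarrow>
     (\<forall>(x1, y1) \<in> T. \<forall>(x2, y2) \<in> T. (x1 - x2) \<bullet> (y1 - y2) \<ge> 0)"

definition cyclically_monotone_set :: "('a::real_inner \<times> 'a) set \<Rightarrow> bool" where
  "cyclically_monotone_set T \<longleftrightarrow>
     (\<forall>n\<ge>2. \<forall>x y :: nat \<Rightarrow> 'a.
        (\<forall>i\<in>{1..n}. (x i, y i) \<in> T) \<longrightarrow> y (n + 1) = y 1 \<longrightarrow>
        (\<Sum>i=1..n. x i \<bullet> y i) \<ge> (\<Sum>i=1..n. x i \<bullet> y (i + 1)))"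

definition monotone_zero_couplings ::
  "'a::euclidean_space measure \<Rightarrow> 'a measure \<Rightarrow> ('a \<times> 'a) measure set" where
  "monotone_zero_couplings \<mu> \<nu> = {\<gamma> \<in> zero_couplings \<mu> \<nu>. monotone_set (spt \<gamma>)}"

definition cyclically_monotone_zero_couplings ::
  "'a::euclidean_space measure \<Rightarrow> 'a measure \<Rightarrow> ('a \<times> 'a) measure set" where
  "cyclically_monotone_zero_couplings \<mu> \<nu> =
     {\<gamma> \<in> zero_couplings \<mu> \<nu>. cyclically_monotone_set (spt \<gamma>)}"

definition proper_coupling :: "('a::euclidean_space \<times> 'a) measure \<Rightarrow> bool" where
  "proper_coupling \<gamma> \<longleftrightarrow> emeasure \<gamma> ({0} \<times> (UNIV - {0})) = 0"

definition H_plus :: "'a::euclidean_space \<Rightarrow> real \<Rightarrow> 'a set" where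
  "H_plus y \<epsilon> = {x \<in> UNIV - {0}. (x /\<^sub>R norm x) \<bullet> y > \<epsilon>}"

end

theory Submission
  imports Defs
begin

text \<open>
  The idea is that mass sitting over the origin forces an infinite amount of mass into a region
  where the second marginal is finite. A measure off the origin is concentrated on its support
  (\<open>emeasure_eq_0_if_disjoint_spt\<close>). Hence if \<open>\<gamma>\<close> charges \<open>{0} \<times> (UNIV - {0})\<close>, some \<open>(0, y\<^sub>0)\<close>
  with \<open>y\<^sub>0 \<noteq> 0\<close> lies in \<open>spt \<gamma>\<close>, and then \<open>y\<^sub>0 \<in> spt \<nu>\<close>. Comparing with \<open>(0, y\<^sub>0)\<close>,
  monotonicity says \<open>x \<bullet> y \<ge> x \<bullet> y\<^sub>0\<close> for every \<open>(x, y) \<in> spt \<gamma>\<close>. When \<open>x\<close> lies in the cone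
  \<open>H_plus y\<^sub>0 \<epsilon>\<close>, the right-hand side exceeds \<open>\<epsilon> \<parallel>x\<parallel>\<close>, so Cauchy-Schwarz gives \<open>\<parallel>y\<parallel> > \<epsilon>\<close>.
  Thus \<open>\<gamma>\<close> couples all of the cone to \<open>{y. \<parallel>y\<parallel> > \<epsilon>}\<close>, which is impossible: the cone has infinite
  \<open>\<mu>\<close>-mass for a suitable \<open>\<epsilon>\<close>, while \<open>{y. \<parallel>y\<parallel> > \<epsilon>}\<close> is bounded away from the origin and so has
  finite \<open>\<nu>\<close>-mass. Cyclically monotone sets are monotone, being tested on cycles of length two.
\<close>

lemma sets_borel_measure_off_0_iff:
  assumes "M \<in> borel_measures_off_0"
  shows "A \<in> sets M \<longleftrightarrow> A \<in> sets borel \<and> 0 \<notin> A"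
  using assms by (auto simp: borel_measures_off_0_def sets_restrict_space_iff)

text \<open>Each point outside the support has a null open neighbourhood; since Euclidean spaces are
  Lindelof, countably many of these already cover the set.\<close>

lemma emeasure_eq_0_if_disjoint_spt:
  fixes M :: "'a::euclidean_space measure"
  assumes M: "M \<in> borel_measures_off_0" and disj: "S \<inter> spt M = {}"
  shows "emeasure M S = 0"
proof (cases "S \<in> sets M")
  case True
  define \<F> where "\<F> = {U. open U \<and> emeasure M (U - {0}) = 0}"
  obtain \<G> where \<G>: "\<G> \<subseteq> \<F>" "countable \<G>" "\<Union>\<G> = \<Union>\<F>"
    using Lindelof[of \<F>] unfolding \<F>_def by blast
  have cover: "S \<subseteq> (\<Union>U\<in>\<G>. U - {0})"
  proof
    fix x assume x: "x \<in> S"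
    then have "x \<noteq> 0" using True sets_borel_measure_off_0_iff[OF M] by auto
    moreover have "x \<in> \<Union>\<F>"
    proof -
      have "x \<notin> spt M" using x disj by blast
      then obtain U where "open U" "x \<in> U" "\<not> 0 < emeasure M (U - {0})"
        unfolding spt_def by blast
      then have "U \<in> \<F>" by (simp add: \<F>_def)
      then show ?thesis using \<open>x \<in> U\<close> by blast
    qed
    ultimately show "x \<in> (\<Union>U\<in>\<G>. U - {0})" using \<G>(3) by auto
  qed
  have "(\<Union>U\<in>\<G>. U - {0}) \<in> null_sets M"
  proof (rule null_sets_UN')
    fix U assume "U \<in> \<G>"
    with \<G>(1) have "open U" "emeasure M (U - {0}) = 0" by (auto simp: \<F>_def)
    then show "U - {0} \<in> null_sets M"
      by (simp add: null_sets_def sets_borel_measure_off_0_iff[OF M])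
  qed (use \<G>(2) in simp)
  then show ?thesis
    using cover True by (meson null_sets_subset null_setsD1)
next
  case False
  then show ?thesis by (simp add: emeasure_notin_sets)
qed

lemma zero_coupling_marginals:
  assumes "\<gamma> \<in> zero_couplings \<mu> \<nu>" and "A \<in> sets borel" and "0 \<notin> A"
  shows "emeasure \<gamma> (A \<times> UNIV) = emeasure \<mu> A" and "emeasure \<gamma> (UNIV \<times> A) = emeasure \<nu> A"
  using assms unfolding zero_couplings_def by blast+

text \<open>Since \<open>y \<noteq> 0\<close>, a neighbourhood \<open>U\<close> of \<open>y\<close> lifts to a neighbourhood \<open>UNIV \<times> (U - {0})\<close> of
  \<open>(x, y)\<close> that misses the origin, and the marginal condition computes its mass.\<close>

lemma zero_coupling_spt_snd:
  assumes \<gamma>: "\<gamma> \<in> zero_couplings \<mu> \<nu>" and xy: "(x, y) \<in> spt \<gamma>" and "y \<noteq> 0"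
  shows "y \<in> spt \<nu>"
  unfolding spt_def
proof (clarify)
  fix U :: "'a set" assume U: "open U" "y \<in> U"
  have "open ((UNIV :: 'a set) \<times> (U - {0}))"
    using U by (intro open_Times) auto
  moreover have "(x, y) \<in> UNIV \<times> (U - {0})" using U \<open>y \<noteq> 0\<close> by auto
  ultimately have "0 < emeasure \<gamma> (UNIV \<times> (U - {0}) - {0})"
    using xy unfolding spt_def by blast
  also have "UNIV \<times> (U - {0}) - {0} = (UNIV :: 'a set) \<times> (U - {0})"
    by (auto simp: zero_prod_def)
  also have "emeasure \<gamma> \<dots> = emeasure \<nu> (U - {0})"
    using U by (intro zero_coupling_marginals(2)[OF \<gamma>]) auto
  finally show "0 < emeasure \<nu> (U - {0})" .
qed

lemma M0_outside_ball_finite: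
  fixes \<nu> :: "'a::euclidean_space measure"
  assumes \<nu>: "\<nu> \<in> M0" and "\<epsilon> > 0"
  shows "emeasure \<nu> {y. norm y > \<epsilon>} < \<infinity>"
proof -
  have "open {y::'a. norm y > \<epsilon>}"
    by (intro open_Collect_less continuous_intros)
  then have "{y. norm y > \<epsilon>} \<in> sets \<nu>"
    using \<nu> \<open>\<epsilon> > 0\<close> by (auto simp: M0_def sets_borel_measure_off_0_iff)
  moreover have "closure {y::'a. norm y > \<epsilon>} \<subseteq> {y. norm y \<ge> \<epsilon>}"
    by (intro closure_minimal closed_Collect_le continuous_intros) auto
  then have "0 \<notin> closure {y::'a. norm y > \<epsilon>}" using \<open>\<epsilon> > 0\<close> by auto
  ultimately show ?thesis using \<nu> by (auto simp: M0_def)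
qed

text \<open>The factor \<open>\<parallel>x\<parallel>\<close> from the cone condition cancels against the one from Cauchy-Schwarz, so
  the bound on \<open>y\<close> does not degenerate as \<open>x\<close> approaches \<open>0\<close>, where the infinite mass sits.\<close>

lemma monotone_set_H_plus_norm_gt:
  assumes mono: "monotone_set T" and "(0, y\<^sub>0) \<in> T" "(x, y) \<in> T" and x: "x \<in> H_plus y\<^sub>0 \<epsilon>"
  shows "norm y > \<epsilon>"
proof -
  have "\<epsilon> * norm x < x \<bullet> y\<^sub>0"
    using x by (auto simp: H_plus_def field_simps)
  also have "x \<bullet> y\<^sub>0 \<le> x \<bullet> y"
    using assms(1-3) by (fastforce simp: monotone_set_def inner_diff_right)
  also have "x \<bullet> y \<le> norm y * norm x"
    using norm_cauchy_schwarz[of x y] by (simp add: mult.commute)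
  finally show ?thesis by (rule mult_right_less_imp_less) simp
qed

proposition monotone_zero_coupling_proper:
  fixes \<mu> \<nu> :: "'a::euclidean_space measure"
  assumes \<mu>: "\<mu> \<in> M0" and \<nu>: "\<nu> \<in> M0"
    and inf: "\<forall>y \<in> spt \<nu> - {0}. \<exists>\<epsilon>>0. emeasure \<mu> (H_plus y \<epsilon>) = \<infinity>"
    and \<gamma>: "\<gamma> \<in> zero_couplings \<mu> \<nu>" and mono: "monotone_set (spt \<gamma>)"
  shows "proper_coupling \<gamma>"
proof (rule ccontr)
  have \<gamma>0: "\<gamma> \<in> borel_measures_off_0" using \<gamma> by (simp add: zero_couplings_def)
  assume "\<not> proper_coupling \<gamma>"
  then have "({0} \<times> (UNIV - {0})) \<inter> spt \<gamma> \<noteq> {}"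
    using emeasure_eq_0_if_disjoint_spt[OF \<gamma>0] by (auto simp: proper_coupling_def)
  then obtain y\<^sub>0 where y0: "(0, y\<^sub>0) \<in> spt \<gamma>" "y\<^sub>0 \<noteq> 0" by auto
  then obtain \<epsilon> where "\<epsilon> > 0" and Hinf: "emeasure \<mu> (H_plus y\<^sub>0 \<epsilon>) = \<infinity>"
    using inf zero_coupling_spt_snd[OF \<gamma>] by blast
  define H where "H = H_plus y\<^sub>0 \<epsilon>"
  define V where "V = {y::'a. norm y > \<epsilon>}"
  \<comment> \<open>Non-measurable sets have \<open>emeasure\<close> zero, so infinite mass entails measurability.\<close>
  have "H \<in> sets \<mu>"
    using Hinf emeasure_notin_sets[of H \<mu>] by (auto simp: H_def)
  then have H: "H \<in> sets borel" "0 \<notin> H"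
    using \<mu> by (auto simp: M0_def sets_borel_measure_off_0_iff)
  have "open V" unfolding V_def by (intro open_Collect_less continuous_intros)
  then have V: "V \<in> sets borel" "0 \<notin> V" using \<open>\<epsilon> > 0\<close> by (auto simp: V_def)
  have HU: "H \<times> UNIV \<in> sets \<gamma>" and UV: "UNIV \<times> V \<in> sets \<gamma>"
    using H V by (auto simp: sets_borel_measure_off_0_iff[OF \<gamma>0] zero_prod_def intro!: borel_Times)
  have null: "emeasure \<gamma> (H \<times> UNIV - UNIV \<times> V) = 0"
  proof (rule emeasure_eq_0_if_disjoint_spt[OF \<gamma>0])
    show "(H \<times> UNIV - UNIV \<times> V) \<inter> spt \<gamma> = {}"
      using monotone_set_H_plus_norm_gt[OF mono y0(1)] by (auto simp: H_def V_def)
  qed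
  have "\<infinity> = emeasure \<gamma> (H \<times> UNIV)"
    using zero_coupling_marginals(1)[OF \<gamma> H] Hinf by (simp only: H_def)
  also have "\<dots> \<le> emeasure \<gamma> (UNIV \<times> V \<union> (H \<times> UNIV - UNIV \<times> V))"
    using HU UV by (intro emeasure_mono) auto
  also have "\<dots> \<le> emeasure \<gamma> (UNIV \<times> V) + emeasure \<gamma> (H \<times> UNIV - UNIV \<times> V)"
    using HU UV by (intro emeasure_subadditive) auto
  also have "\<dots> = emeasure \<nu> V"
    using zero_coupling_marginals(2)[OF \<gamma> V] null by simp
  also have "\<dots> < \<infinity>"
    using M0_outside_ball_finite[OF \<nu> \<open>\<epsilon> > 0\<close>] by (simp add: V_def)
  finally show False by simp
qed

lemma cyclically_monotone_imp_monotone: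
  assumes cm: "cyclically_monotone_set T"
  shows "monotone_set T"
  unfolding monotone_set_def
proof clarify
  fix x1 y1 x2 y2 assume T: "(x1, y1) \<in> T" "(x2, y2) \<in> T"
  define x where "x = (\<lambda>i::nat. if i = 1 then x1 else x2)"
  \<comment> \<open>The index 3 closes the cycle, so \<open>y\<close> has to return to \<open>y1\<close> there.\<close>
  define y where "y = (\<lambda>i::nat. if i = 2 then y2 else y1)"
  have eq: "{1..2::nat} = {1, 2}" by auto
  have cycle: "\<forall>i\<in>{1..2}. (x i, y i) \<in> T" "y (2 + 1) = y 1"
    using T by (auto simp: eq x_def y_def)
  have "(\<Sum>i=1..2. x i \<bullet> y i) \<ge> (\<Sum>i=1..2. x i \<bullet> y (i + 1))"
    by (rule cm[unfolded cyclically_monotone_set_def, THEN spec, THEN mp, THEN spec, THEN spec,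
          THEN mp, THEN mp, OF order_refl cycle])
  then have "x1 \<bullet> y1 + x2 \<bullet> y2 \<ge> x1 \<bullet> y2 + x2 \<bullet> y1"
    unfolding eq x_def y_def by simp
  then show "(x1 - x2) \<bullet> (y1 - y2) \<ge> 0"
    by (simp add: inner_diff_left inner_diff_right)
qed

theorem proposition3p5:
  fixes \<mu> \<nu> :: "(real ^ 'd) measure"
  assumes "\<mu> \<in> M0" and "\<nu> \<in> M0"
    and "\<forall>y \<in> spt \<nu> - {0}. \<exists>\<epsilon>>0. emeasure \<mu> (H_plus y \<epsilon>) = \<infinity>"
  shows "(\<forall>\<gamma> \<in> monotone_zero_couplings \<mu> \<nu>. proper_coupling \<gamma>) \<and>
         (\<forall>\<gamma> \<in> cyclically_monotone_zero_couplings \<mu> \<nu>. proper_coupling \<gamma>)"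
proof -
  have "\<forall>\<gamma> \<in> monotone_zero_couplings \<mu> \<nu>. proper_coupling \<gamma>"
  proof
    fix \<gamma> assume "\<gamma> \<in> monotone_zero_couplings \<mu> \<nu>"
    then have "\<gamma> \<in> zero_couplings \<mu> \<nu>" "monotone_set (spt \<gamma>)"
      by (simp_all add: monotone_zero_couplings_def)
    then show "proper_coupling \<gamma>"
      by (rule monotone_zero_coupling_proper[OF assms])
  qed
  moreover have "cyclically_monotone_zero_couplings \<mu> \<nu> \<subseteq> monotone_zero_couplings \<mu> \<nu>"
    by (simp add: cyclically_monotone_zero_couplings_def monotone_zero_couplings_def
        Collect_mono cyclically_monotone_imp_monotone)
  ultimately show ?thesis by blast
qed

end
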